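(* Let $n\ge 1$, let $A_1,A_2\in\mathbb{R}^{n\times n}$, let $u_1,u_2\in\mathbb{R}^n$ have nonnegative entries, and let $R_\alpha:\mathbb{R}^n\to\mathbb{R}\cup\{+\infty\}$ be a convex function. Then the minimization problem $$\min_{\alpha\in\mathbb{R}^n}\ \sum_{i=1}^n\sum_{j=1}^2 u_j[i]\left[(A_j\alpha)[i]+\log\left(\sum_{k=1}^2\exp\bigl(-(A_k\alpha)[i]\bigr)\right)\right]+R_\alpha(\alpha)$$ is convex, i.e. its objective is a convex function of $\alpha$ on $\mathbb{R}^n$.
   Context: For a vector $v\in\mathbb{R}^n$, $v[i]$ denotes its $i$-th entry. *)

theory Defs
  imports "HOL-Analysis.Analysis" "HOL-Library.Extended_Real"
begin

text \<open>
  The library's \<open>convex_on\<close> only covers real-valued functions. For functions into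
  \<open>\<real> \<union> {+\<infinity>}\<close> we use \<open>ereal\<close> with the value \<open>-\<infinity>\<close> excluded. At the endpoints
  \<open>t = 0\<close> and \<open>t = 1\<close> the inequality holds trivially, since \<open>0 * \<infinity> = 0\<close> in \<open>ereal\<close>.
\<close>

definition ext_convex_on :: "'a::real_vector set \<Rightarrow> ('a \<Rightarrow> ereal) \<Rightarrow> bool" where
  "ext_convex_on S f \<longleftrightarrow>
     convex S \<and>
     (\<forall>x\<in>S. f x \<noteq> -\<infinity>) \<and>
     (\<forall>t. 0 \<le> t \<longrightarrow> t \<le> 1 \<longrightarrow> (\<forall>x\<in>S. \<forall>y\<in>S.
        f ((1 - t) *\<^sub>R x + t *\<^sub>R y) \<le> ereal (1 - t) * f x + ereal t * f y))"

definition objective ::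
  "(nat \<Rightarrow> real^'n^'n) \<Rightarrow> (nat \<Rightarrow> real^'n) \<Rightarrow> (real^'n \<Rightarrow> ereal) \<Rightarrow> real^'n \<Rightarrow> ereal" where
  "objective A u R \<alpha> =
     ereal (\<Sum>i\<in>UNIV. \<Sum>j=1..2.
        u j $ i * ((A j *v \<alpha>) $ i + ln (\<Sum>k=1..2. exp (- ((A k *v \<alpha>) $ i)))))
     + R \<alpha>"

end

theory Submission
  imports Defs
begin

text \<open>
  Convexity of log-sum-exp is obtained by normalising: with \<open>S = \<Sum>k. exp (a k)\<close> and
  \<open>T = \<Sum>k. exp (b k)\<close>, convexity of \<open>exp\<close> applied to \<open>a k - ln S\<close> and \<open>b k - ln T\<close> bounds the
  \<open>k\<close>-th term by \<open>(1 - t) * exp (a k) / S + t * exp (b k) / T\<close>, and these bounds sum to \<open>1\<close>.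
\<close>

lemma log_sum_exp_convex:
  fixes a b :: "'k \<Rightarrow> real"
  assumes "finite K" "K \<noteq> {}" "0 \<le> t" "t \<le> 1"
  shows "ln (\<Sum>k\<in>K. exp ((1 - t) * a k + t * b k))
    \<le> (1 - t) * ln (\<Sum>k\<in>K. exp (a k)) + t * ln (\<Sum>k\<in>K. exp (b k))"
proof -
  define S T where "S = (\<Sum>k\<in>K. exp (a k))" and "T = (\<Sum>k\<in>K. exp (b k))"
  have pos: "0 < (\<Sum>k\<in>K. exp (c k))" for c :: "'k \<Rightarrow> real"
    using assms by (intro sum_pos) auto
  have S: "S > 0" and T: "T > 0"
    unfolding S_def T_def by (rule pos)+
  \<comment> \<open>\<open>M\<close> is the claimed upper bound. Subtracting it from the exponent
    shifts \<open>a k\<close> by \<open>ln S\<close> and \<open>b k\<close> by \<open>ln T\<close>,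
    so it remains to show that the shifted exponentials sum to at most 1.\<close>
  define M where "M = (1 - t) * ln S + t * ln T"
  have "exp ((1 - t) * a k + t * b k - M) \<le> (1 - t) * (exp (a k) / S) + t * (exp (b k) / T)" for k
  proof -
    have "exp ((1 - t) *\<^sub>R (a k - ln S) + t *\<^sub>R (b k - ln T))
        \<le> (1 - t) * exp (a k - ln S) + t * exp (b k - ln T)"
      using assms by (intro convex_onD[OF exp_convex]) auto
    also have "(1 - t) *\<^sub>R (a k - ln S) + t *\<^sub>R (b k - ln T) = (1 - t) * a k + t * b k - M"
      by (simp add: M_def algebra_simps)
    finally show ?thesis
      using S T by (simp add: exp_diff)
  qed
  then have "(\<Sum>k\<in>K. exp ((1 - t) * a k + t * b k - M))
      \<le> (\<Sum>k\<in>K. (1 - t) * (exp (a k) / S) + t * (exp (b k) / T))"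
    by (rule sum_mono)
  also have "\<dots> = (1 - t) * (S / S) + t * (T / T)"
    by (simp add: sum.distrib S_def T_def flip: sum_distrib_left sum_divide_distrib)
  also have "\<dots> = 1"
    using S T by simp
  finally have "(\<Sum>k\<in>K. exp ((1 - t) * a k + t * b k)) \<le> exp M"
    by (simp add: exp_diff flip: sum_divide_distrib)
  then have "ln (\<Sum>k\<in>K. exp ((1 - t) * a k + t * b k)) \<le> ln (exp M)"
    by (rule ln_mono[OF _ pos])
  then show ?thesis
    by (simp add: M_def S_def T_def)
qed

text \<open>Linear maps turn a convex combination of points into the same combination of values, so
  \<open>log_sum_exp_convex\<close> applies with \<open>f k x\<close> and \<open>f k y\<close> in
  place of \<open>a k\<close> and \<open>b k\<close>.\<close>

lemma convex_on_log_sum_exp_linear: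
  assumes "finite K" "K \<noteq> {}" "\<And>k. k \<in> K \<Longrightarrow> linear (f k)"
  shows "convex_on UNIV (\<lambda>x. ln (\<Sum>k\<in>K. exp (f k x :: real)))"
proof (rule convex_onI)
  fix t x y assume "0 < (t::real)" "t < 1"
  have "(\<Sum>k\<in>K. exp (f k ((1 - t) *\<^sub>R x + t *\<^sub>R y)))
      = (\<Sum>k\<in>K. exp ((1 - t) * f k x + t * f k y))"
    using assms(3) by (intro sum.cong) (simp_all add: linear_add linear_scale)
  then show "ln (\<Sum>k\<in>K. exp (f k ((1 - t) *\<^sub>R x + t *\<^sub>R y)))
      \<le> (1 - t) * ln (\<Sum>k\<in>K. exp (f k x)) + t * ln (\<Sum>k\<in>K. exp (f k y))"
    using log_sum_exp_convex[OF assms(1,2)] \<open>0 < t\<close> \<open>t < 1\<close> by simp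
qed simp

lemma convex_on_sum_fun:
  assumes "finite I" "convex S" "\<And>i. i \<in> I \<Longrightarrow> convex_on S (f i)"
  shows "convex_on S (\<lambda>x. \<Sum>i\<in>I. f i x)"
  using assms(1,3)
proof (induction I rule: finite_induct)
  case empty
  then show ?case
    using assms(2) by (simp add: convex_on_const)
qed (simp add: convex_on_add)

text \<open>The two convexity inequalities add up by monotonicity of addition; the delicate point is
  regrouping the bound, since distributivity can fail in \<open>ereal\<close>.\<close>

lemma ext_convex_on_add_real:
  assumes g: "convex_on S g" and f: "ext_convex_on S f"
  shows "ext_convex_on S (\<lambda>x. ereal (g x) + f x)"
  unfolding ext_convex_on_def
proof (intro conjI allI impI ballI)
  show "convex S"
    using f by (simp add: ext_convex_on_def)
  show "ereal (g x) + f x \<noteq> -\<infinity>" if "x \<in> S" for x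
    using f that by (simp add: ext_convex_on_def)
  fix t :: real and x y
  assume t: "0 \<le> t" "t \<le> 1" and xy: "x \<in> S" "y \<in> S"
  let ?z = "(1 - t) *\<^sub>R x + t *\<^sub>R y"
  have "g ?z \<le> (1 - t) * g x + t * g y"
    using convex_onD[OF g] t xy by simp
  moreover have "f ?z \<le> ereal (1 - t) * f x + ereal t * f y"
    using f t xy by (simp add: ext_convex_on_def)
  ultimately have "ereal (g ?z) + f ?z
      \<le> ereal ((1 - t) * g x + t * g y) + (ereal (1 - t) * f x + ereal t * f y)"
    by (intro add_mono) simp_all
  also have "\<dots> = ereal (1 - t) * (ereal (g x) + f x) + ereal t * (ereal (g y) + f y)"
  proof -
    have "f x \<noteq> -\<infinity>" "f y \<noteq> -\<infinity>"
      using f xy by (auto simp: ext_convex_on_def)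
    then show ?thesis
      \<comment> \<open>Only finite values and +\<infinity> remain. A positive weight on
        +\<infinity> makes both sides infinite; a zero weight (\<open>t = 0\<close> or
        \<open>t = 1\<close>) removes that summand from both sides because 0 * \<infinity> =
        0.\<close>
      using t by (cases "f x"; cases "f y"; cases "t = 0"; cases "t = 1")
        (auto simp: algebra_simps zero_ereal_def[symmetric])
  qed
  finally show "ereal (g ?z) + f ?z
      \<le> ereal (1 - t) * (ereal (g x) + f x) + ereal t * (ereal (g y) + f y)" .
qed

theorem proposition1:
  fixes A :: "nat \<Rightarrow> real^'n^'n"
    and u :: "nat \<Rightarrow> real^'n"
    and R\<^sub>\<alpha> :: "real^'n \<Rightarrow> ereal"
  assumes "\<And>j i. j \<in> {1..2} \<Longrightarrow> 0 \<le> u j $ i"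
    and "ext_convex_on UNIV R\<^sub>\<alpha>"
  shows "ext_convex_on UNIV (objective A u R\<^sub>\<alpha>)"
proof -
  \<comment> \<open>Linearity serves twice: for the linear term of the bracket and, after negation,
    for the exponents of log-sum-exp.\<close>
  have lin: "linear (\<lambda>\<alpha>. (A k *v \<alpha>) $ i)" for k i
    by (simp add: linear_iff matrix_vector_right_distrib matrix_vector_mult_scaleR)
  have "convex_on UNIV (\<lambda>\<alpha>. (A j *v \<alpha>) $ i)" for j i
    by (rule convex_onI) (simp_all add: linear_add[OF lin] linear_scale[OF lin])
  moreover have "convex_on UNIV (\<lambda>\<alpha>. ln (\<Sum>k=1..2. exp (- ((A k *v \<alpha>) $ i))))" for i
    by (rule convex_on_log_sum_exp_linear) (auto intro: linear_compose_neg lin)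
  \<comment> \<open>Each bracket is a sum of two convex functions; nonnegativity of the weights
    \<open>u j $ i\<close> keeps the scaled brackets convex.\<close>
  ultimately have "convex_on UNIV (\<lambda>\<alpha>. \<Sum>i\<in>UNIV. \<Sum>j=1..2.
      u j $ i * ((A j *v \<alpha>) $ i + ln (\<Sum>k=1..2. exp (- ((A k *v \<alpha>) $ i)))))"
    using assms(1) by (intro convex_on_sum_fun convex_on_cmul convex_on_add) auto
  from ext_convex_on_add_real[OF this assms(2)] show ?thesis
    by (simp add: objective_def[abs_def])
qed

end
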